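(* Let $a(t)$ be the oil demand at time $t$ of the country which does not produce oil. Then a necessary optimality condition to minimize the super costs $S(t)=(p(t)-29)\,a(t)$ for a country which does not produce oil is $$a^{*}(t)=\frac{c_0\exp(-\alpha t)}{2\,(p(t)-29)^{2}},$$ where $c_0$ is a real constant.
   Context: Here $p(t)$ is the price applied in the world for buying a barrel of oil at time $t$, and $29$ (dollars) is a reference "reasonable" price per barrel. The super cost supported by the country which does not produce oil is $S(t)=(p(t)-29)a(t)$ (the "Wade Formula"). The world oil reserves $R(t)$ evolve according to $\frac{dR}{dt}=-v(t)+\alpha R(t)$, where $v(t)$ is the world demand at time $t$ and $\alpha\in[0,1)$ is the rate of increase of oil in the world, taken to be a real constant. Minimizing the super costs is understood as follows: for a fixed time $T$ and $m\in\mathbb{N}$, minimize $\int_0^T S(t)^m\,dt$ subject to $\frac{dR}{dt}=-v(t)+\alpha R(t)$ on $[0,T]$ and $R(0)=Q$, where $Q$ is the initial stock of the reserves and $v=a+w$, with $a$ the demand of the non-producing country and $w$ the remaining part of the world demand. The displayed formula is the one corresponding to $m=2$. The necessary conditions are those of the Hamiltonian $H=S(t)^m+\lambda(t)(-v(t)+\alpha R(t))$ with Pontryagin multiplier $\lambda$, namely $\frac{\partial H}{\partial R}=-\frac{d\lambda}{dt}$ and $\frac{\partial H}{\partial a}=0$; the constant $c_0$ is the one in $\lambda(t)=c_0\exp(-\alpha t)$. *)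

theory Defs
  imports "HOL-Analysis.Analysis"
begin

text \<open>
  Price \<open>p\<close>, demand \<open>a\<close>, remaining demand \<open>w\<close>, reserves \<open>R\<close> and multiplier \<open>\<mu>\<close> are functions
  of time; only their values on \<open>{0..T}\<close> matter.  Demands are real valued and carry no sign
  constraint, in accordance with the stationarity condition being an equation.
\<close>

definition super_cost :: "real \<Rightarrow> real \<Rightarrow> real" where
  "super_cost price demand = (price - 29) * demand"

text \<open>One-sided derivatives of \<open>R\<close> are meant at the end points \<open>0\<close> and \<open>T\<close>.\<close>

definition admissible ::
  "real \<Rightarrow> (real \<Rightarrow> real) \<Rightarrow> real \<Rightarrow> real \<Rightarrow> (real \<Rightarrow> real) \<Rightarrow> (real \<Rightarrow> real) \<Rightarrow> bool" where
  "admissible \<alpha> w T Q a R \<longleftrightarrow>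
     continuous_on {0..T} a \<and> R 0 = Q \<and>
     (\<forall>t\<in>{0..T}. (R has_real_derivative (- (a t + w t) + \<alpha> * R t)) (at t within {0..T}))"

definition total_super_cost ::
  "nat \<Rightarrow> (real \<Rightarrow> real) \<Rightarrow> real \<Rightarrow> (real \<Rightarrow> real) \<Rightarrow> real" where
  "total_super_cost m p T a = integral {0..T} (\<lambda>t. super_cost (p t) (a t) ^ m)"

definition minimizes_super_cost ::
  "nat \<Rightarrow> real \<Rightarrow> (real \<Rightarrow> real) \<Rightarrow> (real \<Rightarrow> real) \<Rightarrow> real \<Rightarrow> real \<Rightarrow>
   (real \<Rightarrow> real) \<Rightarrow> (real \<Rightarrow> real) \<Rightarrow> bool" where
  "minimizes_super_cost m \<alpha> p w T Q a R \<longleftrightarrow>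
     admissible \<alpha> w T Q a R \<and>
     (\<forall>b X. admissible \<alpha> w T Q b X \<longrightarrow> total_super_cost m p T a \<le> total_super_cost m p T b)"

text \<open>In the Hamiltonian, \<open>r\<close>, \<open>u\<close> and \<open>l\<close> are the values of reserves, demand and multiplier.\<close>

definition hamiltonian ::
  "nat \<Rightarrow> real \<Rightarrow> (real \<Rightarrow> real) \<Rightarrow> (real \<Rightarrow> real) \<Rightarrow> real \<Rightarrow> real \<Rightarrow> real \<Rightarrow> real \<Rightarrow> real" where
  "hamiltonian m \<alpha> p w t r u l = super_cost (p t) u ^ m + l * (- (u + w t) + \<alpha> * r)"

text \<open>
  The adjoint equation \<open>\<partial>H/\<partial>R = - d\<mu>/dt\<close> and the stationarity condition \<open>\<partial>H/\<partial>a = 0\<close>.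
  No transversality condition on \<open>\<mu> T\<close> is included.
\<close>

definition hamiltonian_conditions ::
  "nat \<Rightarrow> real \<Rightarrow> (real \<Rightarrow> real) \<Rightarrow> (real \<Rightarrow> real) \<Rightarrow> real \<Rightarrow>
   (real \<Rightarrow> real) \<Rightarrow> (real \<Rightarrow> real) \<Rightarrow> (real \<Rightarrow> real) \<Rightarrow> bool" where
  "hamiltonian_conditions m \<alpha> p w T a R \<mu> \<longleftrightarrow>
     (\<forall>t\<in>{0..T}.
        (\<mu> has_real_derivative - deriv (\<lambda>r. hamiltonian m \<alpha> p w t r (a t) (\<mu> t)) (R t))
          (at t within {0..T}) \<and>
        ((\<lambda>u. hamiltonian m \<alpha> p w t (R t) u (\<mu> t)) has_real_derivative 0) (at (a t)))"

end

theory Submission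
  imports Defs
begin

text \<open>
  For \<open>m = 2\<close> the adjoint equation is \<open>\<mu>' = - \<alpha> \<mu>\<close>, which forces \<open>\<mu> t = c0 exp (- \<alpha> t)\<close>, and
  stationarity is \<open>2 (p t - 29)\<^sup>2 a t = \<mu> t\<close>.  The terminal stock is free, so the zero demand is
  admissible and has cost \<open>0\<close>; hence the super cost of any minimizer vanishes identically and
  \<open>\<mu> = 0\<close> is a multiplier for it.
\<close>

lemma deriv_hamiltonian_reserves: "deriv (\<lambda>r. hamiltonian m \<alpha> p w t r u l) x = \<alpha> * l"
  unfolding hamiltonian_def
  by (rule DERIV_imp_deriv) (auto intro!: derivative_eq_intros)

lemma has_real_derivative_hamiltonian_demand:
  "((\<lambda>u. hamiltonian 2 \<alpha> p w t r u l) has_real_derivative 2 * (p t - 29)\<^sup>2 * u - l) (at u)"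
  unfolding hamiltonian_def super_cost_def
  by (auto intro!: derivative_eq_intros simp: power2_eq_square algebra_simps)

text \<open>By uniqueness of derivatives, "has derivative 0" in the demand becomes an equation
  between the known derivative and 0.\<close>

lemma hamiltonian_conditions_2_iff:
  "hamiltonian_conditions 2 \<alpha> p w T a R \<mu> \<longleftrightarrow>
     (\<forall>t\<in>{0..T}. (\<mu> has_real_derivative - \<alpha> * \<mu> t) (at t within {0..T}) \<and>
        2 * (p t - 29)\<^sup>2 * a t = \<mu> t)"
proof -
  have "((\<lambda>u. hamiltonian 2 \<alpha> p w t r u l) has_real_derivative 0) (at u) \<longleftrightarrow>
      2 * (p t - 29)\<^sup>2 * u = l" for t r u l
    using has_real_derivative_hamiltonian_demand[of \<alpha> p w t r l u] DERIV_unique by fastforce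
  then show ?thesis
    unfolding hamiltonian_conditions_def deriv_hamiltonian_reserves by simp
qed

text \<open>Integrating factor: the derivative of \<open>f t * exp (- k * t)\<close> cancels to 0,
  so this product is constant on the interval.\<close>

lemma linear_ode_solution_exp:
  fixes f :: "real \<Rightarrow> real"
  assumes "\<And>t. t \<in> {0..T} \<Longrightarrow> (f has_real_derivative k * f t) (at t within {0..T})"
    and "t \<in> {0..T}"
  shows "f t = f 0 * exp (k * t)"
proof -
  have "((\<lambda>t. f t * exp (- k * t)) has_real_derivative 0) (at s within {0..T})"
    if "s \<in> {0..T}" for s
    using assms(1)[OF that] by (auto intro!: derivative_eq_intros)
  then obtain c where "\<forall>t\<in>{0..T}. f t * exp (- k * t) = c"
    using has_field_derivative_zero_constant[of "{0..T}" "\<lambda>t. f t * exp (- k * t)"] by auto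
  \<comment> \<open>The constant is read off at 0, which lies in the interval because
    \<open>t\<close> does.\<close>
  then have "f t * exp (- k * t) = f 0 * exp (- k * 0)"
    using assms(2) by (metis atLeastAtMost_iff order.refl order.trans)
  then show ?thesis
    by (simp add: exp_minus field_simps)
qed

lemma hamiltonian_conditions_2_demand:
  assumes "hamiltonian_conditions 2 \<alpha> p w T a R \<mu>"
  shows "\<exists>c0. (\<forall>t\<in>{0..T}. \<mu> t = c0 * exp (- \<alpha> * t)) \<and>
    (\<forall>t\<in>{0..T}. p t \<noteq> 29 \<longrightarrow> a t = c0 * exp (- \<alpha> * t) / (2 * (p t - 29)\<^sup>2))"
proof -
  \<comment> \<open>The witness for \<open>c0\<close> is the initial value \<open>\<mu> 0\<close>,
    shared by both formulas.\<close>
  have "\<mu> t = \<mu> 0 * exp (- \<alpha> * t)" if "t \<in> {0..T}" for t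
    using assms that unfolding hamiltonian_conditions_2_iff
    by (intro linear_ode_solution_exp[of T]) auto
  moreover have "a t = \<mu> t / (2 * (p t - 29)\<^sup>2)" if "t \<in> {0..T}" "p t \<noteq> 29" for t
    using assms that unfolding hamiltonian_conditions_2_iff by (auto simp: field_simps)
  ultimately show ?thesis
    by metis
qed

text \<open>Variation of constants solves the reserve equation for any continuous demand, so every
  such demand can compete with a minimizer.\<close>

lemma admissible_exists:
  assumes "continuous_on {0..T} b" "continuous_on {0..T} w"
  shows "\<exists>X. admissible \<alpha> w T Q b X"
proof -
  define g where "g s = exp (- \<alpha> * s) * (b s + w s)" for s
  define X where "X t = exp (\<alpha> * t) * (Q - integral {0..t} g)" for t
  have "continuous_on {0..T} g"
    unfolding g_def using assms by (intro continuous_intros)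
  \<comment> \<open>Continuity of \<open>g\<close> allows the fundamental theorem of calculus,
    one-sided at the end points; the factor \<open>exp (\<alpha> * t)\<close> cancels the
    exponential in \<open>g\<close>.\<close>
  then have "(X has_real_derivative - (b t + w t) + \<alpha> * X t) (at t within {0..T})"
    if "t \<in> {0..T}" for t
    unfolding X_def using that
    by (auto intro!: derivative_eq_intros integral_has_real_derivative
        simp: g_def exp_minus field_simps)
  moreover have "X 0 = Q"
    by (simp add: X_def)
  ultimately show ?thesis
    using assms(1) unfolding admissible_def by blast
qed

lemma minimizer_super_cost_zero:
  assumes "0 < T" "continuous_on {0..T} p" "continuous_on {0..T} w"
    and min: "minimizes_super_cost 2 \<alpha> p w T Q a R" and "t \<in> {0..T}"
  shows "super_cost (p t) (a t) = 0"
proof -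
  define S where "S t = (super_cost (p t) (a t))\<^sup>2" for t
  have cont: "continuous_on {0..T} S"
    using min assms(2) unfolding minimizes_super_cost_def admissible_def S_def super_cost_def
    by (intro continuous_intros) auto
  obtain X where "admissible \<alpha> w T Q (\<lambda>_. 0) X"
    using admissible_exists[of T "\<lambda>_. 0" w] assms(3) by auto
  then have "total_super_cost 2 p T a \<le> total_super_cost 2 p T (\<lambda>_. 0)"
    using min unfolding minimizes_super_cost_def by blast
  then have "integral {0..T} S \<le> 0"
    by (simp add: total_super_cost_def super_cost_def S_def[abs_def])
  moreover have "0 \<le> integral {0..T} S"
    using cont by (intro integral_nonneg integrable_continuous_real) (auto simp: S_def)
  \<comment> \<open>A continuous nonnegative function with integral 0 over a nondegenerate interval
    vanishes at every point, not just almost everywhere.\<close>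
  ultimately have "\<forall>t\<in>{0..T}. S t = 0"
    using integral_eq_0_iff[OF cont \<open>0 < T\<close>] by (auto simp: S_def)
  then show ?thesis
    using \<open>t \<in> {0..T}\<close> by (simp add: S_def)
qed

text \<open>A minimizer has zero demand wherever \<open>p t \<noteq> 29\<close>, which forces
  \<open>c0 = 0\<close> if there is such a time. The second half covers all admissible solutions of
  the Hamiltonian conditions, where \<open>c0\<close> may be nonzero if the price avoids 29.\<close>

theorem theorem3p1:
  fixes p w :: "real \<Rightarrow> real" and \<alpha> T Q :: real
  assumes "0 < T" and "0 \<le> \<alpha>" and "\<alpha> < 1"
    and "continuous_on {0..T} p" and "continuous_on {0..T} w"
  shows "(\<forall>a R. minimizes_super_cost 2 \<alpha> p w T Q a R \<longrightarrow>
            (\<exists>\<mu> c0. hamiltonian_conditions 2 \<alpha> p w T a R \<mu> \<and>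
               (\<forall>t\<in>{0..T}. \<mu> t = c0 * exp (- \<alpha> * t)) \<and>
               (\<forall>t\<in>{0..T}. p t \<noteq> 29 \<longrightarrow> a t = c0 * exp (- \<alpha> * t) / (2 * (p t - 29)\<^sup>2))))
       \<and> (\<forall>a R \<mu>. admissible \<alpha> w T Q a R \<and> hamiltonian_conditions 2 \<alpha> p w T a R \<mu> \<longrightarrow>
            (\<exists>c0. (\<forall>t\<in>{0..T}. \<mu> t = c0 * exp (- \<alpha> * t)) \<and>
               (\<forall>t\<in>{0..T}. p t \<noteq> 29 \<longrightarrow> a t = c0 * exp (- \<alpha> * t) / (2 * (p t - 29)\<^sup>2))))"
proof (intro conjI allI impI)
  fix a R
  assume "minimizes_super_cost 2 \<alpha> p w T Q a R"
  then have "super_cost (p t) (a t) = 0" if "t \<in> {0..T}" for t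
    using minimizer_super_cost_zero assms that by blast
  \<comment> \<open>At each time either the price is 29 or the demand is 0, and in both cases
    \<open>2 * (p t - 29)\<^sup>2 * a t\<close> is 0, as stationarity with the zero multiplier
    asks.\<close>
  then have "hamiltonian_conditions 2 \<alpha> p w T a R (\<lambda>_. 0)"
    unfolding hamiltonian_conditions_2_iff by (auto simp: super_cost_def)
  then show "\<exists>\<mu> c0. hamiltonian_conditions 2 \<alpha> p w T a R \<mu> \<and>
      (\<forall>t\<in>{0..T}. \<mu> t = c0 * exp (- \<alpha> * t)) \<and>
      (\<forall>t\<in>{0..T}. p t \<noteq> 29 \<longrightarrow> a t = c0 * exp (- \<alpha> * t) / (2 * (p t - 29)\<^sup>2))"
    using hamiltonian_conditions_2_demand by blast
next
  fix a R \<mu>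
  assume "admissible \<alpha> w T Q a R \<and> hamiltonian_conditions 2 \<alpha> p w T a R \<mu>"
  then show "\<exists>c0. (\<forall>t\<in>{0..T}. \<mu> t = c0 * exp (- \<alpha> * t)) \<and>
      (\<forall>t\<in>{0..T}. p t \<noteq> 29 \<longrightarrow> a t = c0 * exp (- \<alpha> * t) / (2 * (p t - 29)\<^sup>2))"
    using hamiltonian_conditions_2_demand by blast
qed

end
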